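(* Let $\mathbb{K}=\mathbb{R}$ or $\mathbb{K}=\mathbb{C}$, let $X,Y$ be finite-dimensional normed spaces over $\mathbb{K}$, and let $\Phi,\Psi$ be $\mathbb{K}$-linear flows on $X,Y$, respectively. Then each of the following four statements implies the other three: (i) $\Phi,\Psi$ are $C^1$-orbit equivalent; (ii) $\Phi,\Psi$ are $C^1$-flow equivalent; (iii) $\Phi,\Psi$ are $\mathbb{K}$-linearly flow equivalent; (iv) $A^{\Phi},\alpha A^{\Psi}$ are $\mathbb{K}$-similar for some $\alpha\in\mathbb{R}^+$.
   Context: $\mathbb{R}^+$ denotes the set of positive real numbers. A flow on $X$ is a continuous map $\varphi:\mathbb{R}\times X\to X$ with $\varphi(t,\varphi(s,x))=\varphi(t+s,x)$ and $\varphi(0,x)=x$ for all $t,s\in\mathbb{R}$, $x\in X$; write $\varphi_t=\varphi(t,\cdot)$. A flow $\Phi$ is $\mathbb{K}$-linear if every $\Phi_t$ is $\mathbb{K}$-linear, equivalently $\Phi_t=e^{tA^{\Phi}}$ for all $t\in\mathbb{R}$, with a unique $\mathbb{K}$-linear operator $A^{\Phi}:X\to X$, called the generator of $\Phi$. Flows $\varphi,\psi$ on $X,Y$ are $C^1$-orbit equivalent if there exist a $C^1$-diffeomorphism $h:X\to Y$ and a function $\tau:\mathbb{R}\times X\to\mathbb{R}$, with $\tau(\cdot,x)$ strictly increasing for each $x\in X$ (no other regularity of $\tau$ is assumed), such that $h(\varphi(t,x))=\psi(\tau(t,x),h(x))$ for all $(t,x)\in\mathbb{R}\times X$. Here differentiability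 is understood over $\mathbb{K}$: $h$ is a bijection and $h,h^{-1}$ are continuously differentiable with $\mathbb{K}$-linear derivatives (when $\mathbb{K}=\mathbb{C}$, a real-$C^1$ map need not qualify). The flows are $C^1$-flow equivalent if moreover one can choose $\tau(t,x)=\alpha t$ for all $(t,x)$ with some constant $\alpha\in\mathbb{R}^+$. They are $\mathbb{K}$-linearly flow equivalent if this holds with $\tau(t,x)=\alpha t$ and $h$ a $\mathbb{K}$-linear isomorphism. $\mathbb{K}$-linear operators $A:X\to X$ and $B:Y\to Y$ are $\mathbb{K}$-similar if $HA=BH$ for some $\mathbb{K}$-linear isomorphism $H:X\to Y$. *)

theory Defs
  imports "HOL-Analysis.Analysis"
begin

text \<open>
  A finite-dimensional normed space over \<open>'k\<close>, which is used only for \<open>'k = real\<close> and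
  \<open>'k = complex\<close>. The libraries have no class of complex normed spaces, so the scalar
  multiplication is a parameter. It has to extend the real scalar multiplication belonging to
  the type; for \<open>'k = real\<close> this forces \<open>scale = scaleR\<close>. The zero space is allowed.
\<close>

locale fin_dim_normed_space = vector_space scale
  for scale :: "'k::real_normed_field \<Rightarrow> 'a::real_normed_vector \<Rightarrow> 'a" +
  assumes scale_of_real: "scale (of_real r) x = r *\<^sub>R x"
    and norm_scale: "norm (scale c x) = norm c * norm x"
    and fin_dim: "\<exists>B. finite B \<and> span B = UNIV"

definition lin_iso ::
    "('k::field \<Rightarrow> 'a::ab_group_add \<Rightarrow> 'a) \<Rightarrow> ('k \<Rightarrow> 'b::ab_group_add \<Rightarrow> 'b) \<Rightarrow> ('a \<Rightarrow> 'b) \<Rightarrow> bool"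
  where "lin_iso sX sY H \<longleftrightarrow> Vector_Spaces.linear sX sY H \<and> bij H"

definition flow :: "(real \<Rightarrow> 'a::topological_space \<Rightarrow> 'a) \<Rightarrow> bool"
  where "flow \<phi> \<longleftrightarrow>
    continuous_on UNIV (\<lambda>(t, x). \<phi> t x) \<and>
    (\<forall>t s x. \<phi> t (\<phi> s x) = \<phi> (t + s) x) \<and>
    (\<forall>x. \<phi> 0 x = x)"

definition linear_flow ::
    "('k::field \<Rightarrow> 'a::real_normed_vector \<Rightarrow> 'a) \<Rightarrow> (real \<Rightarrow> 'a \<Rightarrow> 'a) \<Rightarrow> bool"
  where "linear_flow s \<Phi> \<longleftrightarrow> flow \<Phi> \<and> (\<forall>t. Vector_Spaces.linear s s (\<Phi> t))"

text \<open>The exponential \<open>e\<^sup>A\<close> of a linear operator; \<open>A ^^ n\<close> is the \<open>n\<close>-fold composition.\<close>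

definition op_exp :: "('a::real_normed_vector \<Rightarrow> 'a) \<Rightarrow> 'a \<Rightarrow> 'a"
  where "op_exp A x = (\<Sum>n. (A ^^ n) x /\<^sub>R fact n)"

definition generator ::
    "('k::field \<Rightarrow> 'a::real_normed_vector \<Rightarrow> 'a) \<Rightarrow> (real \<Rightarrow> 'a \<Rightarrow> 'a) \<Rightarrow> 'a \<Rightarrow> 'a"
  where "generator s \<Phi> =
    (THE A. Vector_Spaces.linear s s A \<and> (\<forall>t. \<Phi> t = op_exp (\<lambda>x. t *\<^sub>R A x)))"

text \<open>
  Continuous differentiability over the scalar field: the Frechet derivative is linear with
  respect to the given scalar multiplications (not merely over the reals) and depends
  continuously, in operator norm, on the base point.
\<close>

definition C1_map ::
    "('k::field \<Rightarrow> 'a::real_normed_vector \<Rightarrow> 'a) \<Rightarrow> ('k \<Rightarrow> 'b::real_normed_vector \<Rightarrow> 'b) \<Rightarrow>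
     ('a \<Rightarrow> 'b) \<Rightarrow> bool"
  where "C1_map sX sY h \<longleftrightarrow>
    (\<exists>h' :: 'a \<Rightarrow> ('a \<Rightarrow>\<^sub>L 'b). continuous_on UNIV h' \<and>
      (\<forall>x. (h has_derivative blinfun_apply (h' x)) (at x) \<and>
           Vector_Spaces.linear sX sY (blinfun_apply (h' x))))"

definition C1_diffeo ::
    "('k::field \<Rightarrow> 'a::real_normed_vector \<Rightarrow> 'a) \<Rightarrow> ('k \<Rightarrow> 'b::real_normed_vector \<Rightarrow> 'b) \<Rightarrow>
     ('a \<Rightarrow> 'b) \<Rightarrow> bool"
  where "C1_diffeo sX sY h \<longleftrightarrow> bij h \<and> C1_map sX sY h \<and> C1_map sY sX (inv h)"

definition C1_orbit_equivalent ::
    "('k::field \<Rightarrow> 'a::real_normed_vector \<Rightarrow> 'a) \<Rightarrow> ('k \<Rightarrow> 'b::real_normed_vector \<Rightarrow> 'b) \<Rightarrow>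
     (real \<Rightarrow> 'a \<Rightarrow> 'a) \<Rightarrow> (real \<Rightarrow> 'b \<Rightarrow> 'b) \<Rightarrow> bool"
  where "C1_orbit_equivalent sX sY \<phi> \<psi> \<longleftrightarrow>
    (\<exists>h. \<exists>\<tau> :: real \<Rightarrow> 'a \<Rightarrow> real.
      C1_diffeo sX sY h \<and>
      (\<forall>x. strict_mono (\<lambda>t. \<tau> t x)) \<and>
      (\<forall>t x. h (\<phi> t x) = \<psi> (\<tau> t x) (h x)))"

definition C1_flow_equivalent ::
    "('k::field \<Rightarrow> 'a::real_normed_vector \<Rightarrow> 'a) \<Rightarrow> ('k \<Rightarrow> 'b::real_normed_vector \<Rightarrow> 'b) \<Rightarrow>
     (real \<Rightarrow> 'a \<Rightarrow> 'a) \<Rightarrow> (real \<Rightarrow> 'b \<Rightarrow> 'b) \<Rightarrow> bool"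
  where "C1_flow_equivalent sX sY \<phi> \<psi> \<longleftrightarrow>
    (\<exists>h. \<exists>\<alpha> > 0. C1_diffeo sX sY h \<and> (\<forall>t x. h (\<phi> t x) = \<psi> (\<alpha> * t) (h x)))"

text \<open>On finite-dimensional spaces a linear isomorphism is automatically a diffeomorphism.\<close>

definition linearly_flow_equivalent ::
    "('k::field \<Rightarrow> 'a::real_normed_vector \<Rightarrow> 'a) \<Rightarrow> ('k \<Rightarrow> 'b::real_normed_vector \<Rightarrow> 'b) \<Rightarrow>
     (real \<Rightarrow> 'a \<Rightarrow> 'a) \<Rightarrow> (real \<Rightarrow> 'b \<Rightarrow> 'b) \<Rightarrow> bool"
  where "linearly_flow_equivalent sX sY \<phi> \<psi> \<longleftrightarrow>
    (\<exists>h. \<exists>\<alpha> > 0. lin_iso sX sY h \<and> (\<forall>t x. h (\<phi> t x) = \<psi> (\<alpha> * t) (h x)))"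

definition similar_ops ::
    "('k::field \<Rightarrow> 'a::ab_group_add \<Rightarrow> 'a) \<Rightarrow> ('k \<Rightarrow> 'b::ab_group_add \<Rightarrow> 'b) \<Rightarrow>
     ('a \<Rightarrow> 'a) \<Rightarrow> ('b \<Rightarrow> 'b) \<Rightarrow> bool"
  where "similar_ops sX sY A B \<longleftrightarrow> (\<exists>H. lin_iso sX sY H \<and> H \<circ> A = B \<circ> H)"

end

theory Submission imports Defs begin

text \<open>
  Linear flow equivalence trivially implies the two \<open>C\<^sup>1\<close> equivalences, and similarity of the
  generators implies linear flow equivalence through the exponential series. The content is that
  a \<open>C\<^sup>1\<close>-orbit equivalence \<open>h\<close> makes the generators similar up to a positive factor.

  Let \<open>A\<close> and \<open>B\<close> be the generators. Since \<open>h\<close> maps orbits to orbits and preserves their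
  orientation, it maps tangent directions to tangent directions: \<open>Dh(x) A x = c(x) B (h x)\<close> with
  \<open>c(x) \<ge> 0\<close>, and \<open>h\<close> matches the zeros of \<open>A\<close> with those of \<open>B\<close> (\<open>orbit_equivalence_velocity\<close>).
  A time change that is merely increasing suffices, since a monotone function has one-sided
  limits. In particular \<open>B (h 0) = 0\<close>. Putting \<open>x = \<epsilon> v\<close>, dividing by \<open>\<epsilon>\<close> and letting \<open>\<epsilon>\<close> tend
  to zero, one finds for \<open>H = Dh(0)\<close> that \<open>H A v\<close> is a positive multiple of \<open>B H v\<close> whenever \<open>B
  H v \<noteq> 0\<close>, and that the two vanish together. Two linear maps that are proportional at every
  vector in this sense are proportional by one global factor (\<open>linear_pointwise_proportional\<close>),
  so \<open>H A = \<alpha> B H\<close> with \<open>\<alpha> > 0\<close>. The argument takes place over the reals: the scalar field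
  enters only because \<open>H\<close> is linear over it.

  To speak of generators at all, one needs that a continuous linear flow in finite dimension is
  \<open>e\<^sup>t\<^sup>A\<close> for a unique \<open>A\<close> (\<open>generator_eq_velocity\<close>). Its orbits are differentiable because
  averages of orbits are (\<open>orbit_differentiable_at_0\<close>), and then each coordinate of an orbit is
  the sum of its Taylor series (\<open>flow_eq_op_exp\<close>). Finite dimension is a hypothesis and not a
  property of the types, so completeness and boundedness of linear maps are first derived from a
  finite spanning set.
\<close>

section \<open>Finite-dimensional normed spaces\<close>

text \<open>
  A complete subspace \<open>V\<close> is closed, so \<open>v\<close> has positive distance \<open>d\<close> from it, and scaling by
  \<open>c\<close> multiplies the distance by \<open>\<bar>c\<bar>\<close>. This bound on the coefficient of \<open>v\<close> drives the
  inductions over spanning sets below: it makes completeness and boundedness pass from \<open>V\<close> to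
  the span of \<open>V\<close> and \<open>v\<close>.
\<close>

lemma coefficient_bound_off_complete_subspace:
  fixes V :: "'a::real_normed_vector set"
  assumes V: "subspace V" "complete V" and v: "v \<notin> V"
  obtains d where "d > 0" "\<And>c s. s \<in> V \<Longrightarrow> d * \<bar>c\<bar> \<le> norm (s + c *\<^sub>R v)"
proof
  have ne: "V \<noteq> {}" using subspace_0[OF V(1)] by auto
  have cl: "closed V" using V(2) by (rule complete_imp_closed)
  show "infdist v V > 0"
    using in_closed_iff_infdist_zero[OF cl ne, of v] v infdist_nonneg[of v V] by linarith
  fix c s assume s: "s \<in> V"
  show "infdist v V * \<bar>c\<bar> \<le> norm (s + c *\<^sub>R v)"
  proof (cases "c = 0")
    case False
    have "infdist v V \<le> dist v ((- 1 / c) *\<^sub>R s)"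
      by (rule infdist_le[OF subspace_scale[OF V(1) s]])
    then have "infdist v V * \<bar>c\<bar> \<le> norm (v - (- 1 / c) *\<^sub>R s) * \<bar>c\<bar>"
      by (simp add: dist_norm mult_right_mono)
    also have "\<dots> = norm (c *\<^sub>R (v - (- 1 / c) *\<^sub>R s))" by simp
    also have "c *\<^sub>R (v - (- 1 / c) *\<^sub>R s) = s + c *\<^sub>R v"
      using False by (simp add: algebra_simps)
    finally show ?thesis .
  qed simp
qed

lemma complete_span_finite:
  fixes S :: "'a::real_normed_vector set"
  assumes "finite S"
  shows "complete (span S)"
  using assms
proof (induction S rule: finite_induct)
  case empty
  then show ?case by (simp add: compact_imp_complete)
next
  case (insert v S)
  show ?case
  proof (cases "v \<in> span S")
    case True
    then show ?thesis using insert.IH by (simp add: span_redundant)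
  next
    case False
    obtain d where d: "d > 0" and le: "\<And>c s. s \<in> span S \<Longrightarrow> d * \<bar>c\<bar> \<le> norm (s + c *\<^sub>R v)"
      using coefficient_bound_off_complete_subspace[OF subspace_span insert.IH False] by metis
    show ?thesis
      unfolding complete_def
    proof (intro allI impI)
      fix x :: "nat \<Rightarrow> 'a" assume x: "(\<forall>n. x n \<in> span (insert v S)) \<and> Cauchy x"
      then have "\<forall>n. \<exists>k. x n - k *\<^sub>R v \<in> span S" by (simp add: span_insert)
      then obtain c where c: "\<And>n. x n - c n *\<^sub>R v \<in> span S" by metis
      have "Cauchy c"
      proof (rule CauchyI)
        fix e :: real assume "e > 0"
        then have "d * e > 0" using d by simp
        then obtain M where M: "\<forall>m\<ge>M. \<forall>n\<ge>M. norm (x m - x n) < d * e"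
          using CauchyD[of x "d * e"] x by metis
        have "norm (c m - c n) < e" if "m \<ge> M" "n \<ge> M" for m n
        proof -
          have "d * \<bar>c m - c n\<bar>
              \<le> norm (((x m - c m *\<^sub>R v) - (x n - c n *\<^sub>R v)) + (c m - c n) *\<^sub>R v)"
            by (rule le) (intro span_diff c)
          also have "\<dots> = norm (x m - x n)" by (simp add: algebra_simps)
          also have "\<dots> < d * e" using M that by blast
          finally show ?thesis using d by simp
        qed
        then show "\<exists>M. \<forall>m\<ge>M. \<forall>n\<ge>M. norm (c m - c n) < e" by blast
      qed
      then obtain l where l: "c \<longlonglongrightarrow> l" using Cauchy_convergent convergent_def by blast
      have "Cauchy (\<lambda>n. x n - c n *\<^sub>R v)"
      proof (rule CauchyI)
        fix e :: real assume "e > 0"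
        then have e2: "e / 2 > 0" by simp
        have "Cauchy (\<lambda>n. c n *\<^sub>R v)"
          using tendsto_scaleR[OF l tendsto_const[of v]] LIMSEQ_imp_Cauchy by blast
        then obtain N where N: "\<forall>m\<ge>N. \<forall>n\<ge>N. norm (c m *\<^sub>R v - c n *\<^sub>R v) < e / 2"
          using CauchyD[OF _ e2] by metis
        obtain M where M: "\<forall>m\<ge>M. \<forall>n\<ge>M. norm (x m - x n) < e / 2"
          using CauchyD[of x, OF _ e2] x by metis
        have "norm ((x m - c m *\<^sub>R v) - (x n - c n *\<^sub>R v)) < e"
          if "m \<ge> max M N" "n \<ge> max M N" for m n
        proof -
          have "norm ((x m - x n) - (c m *\<^sub>R v - c n *\<^sub>R v)) < e / 2 + e / 2"
            using norm_triangle_ineq4[of "x m - x n" "c m *\<^sub>R v - c n *\<^sub>R v"] M[rule_format, of m n]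
              N[rule_format, of m n] that by simp
          then show ?thesis by (simp add: algebra_simps)
        qed
        then show "\<exists>M. \<forall>m\<ge>M. \<forall>n\<ge>M. norm ((x m - c m *\<^sub>R v) - (x n - c n *\<^sub>R v)) < e" by blast
      qed
      then obtain s where s: "s \<in> span S" "(\<lambda>n. x n - c n *\<^sub>R v) \<longlonglongrightarrow> s"
        using insert.IH[unfolded complete_def, rule_format, of "\<lambda>n. x n - c n *\<^sub>R v"] c by metis
      have "(\<lambda>n. (x n - c n *\<^sub>R v) + c n *\<^sub>R v) \<longlonglongrightarrow> s + l *\<^sub>R v"
        by (intro tendsto_intros s l)
      moreover have "s + l *\<^sub>R v \<in> span (insert v S)"
        using s(1) by (auto simp: span_insert intro!: exI[of _ l])
      ultimately show "\<exists>l\<in>span (insert v S). x \<longlonglongrightarrow> l"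
        by (intro bexI[of _ "s + l *\<^sub>R v"]) simp_all
    qed
  qed
qed

lemma linear_bounded_on_span_finite:
  fixes f :: "'a::real_normed_vector \<Rightarrow> 'b::real_normed_vector"
  assumes "finite S" and f: "linear f"
  shows "\<exists>K. \<forall>x\<in>span S. norm (f x) \<le> K * norm x"
  using assms(1)
proof (induction S rule: finite_induct)
  case empty
  then show ?case using linear_0[OF f] by simp
next
  case (insert v S)
  then obtain K where K: "\<And>x. x \<in> span S \<Longrightarrow> norm (f x) \<le> K * norm x" by blast
  show ?case
  proof (cases "v \<in> span S")
    case True
    then show ?thesis using K by (auto simp: span_redundant)
  next
    case False
    obtain d where d: "d > 0" and le: "\<And>c s. s \<in> span S \<Longrightarrow> d * \<bar>c\<bar> \<le> norm (s + c *\<^sub>R v)"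
      using coefficient_bound_off_complete_subspace
        [OF subspace_span complete_span_finite[OF insert.hyps(1)] False] by metis
    define L where "L = \<bar>K\<bar> * (1 + norm v / d) + norm (f v) / d"
    have "norm (f x) \<le> L * norm x" if "x \<in> span (insert v S)" for x
    proof -
      obtain c where c: "x - c *\<^sub>R v \<in> span S" using \<open>x \<in> _\<close> by (auto simp: span_insert)
      define s where "s = x - c *\<^sub>R v"
      have x: "x = s + c *\<^sub>R v" by (simp add: s_def)
      have s: "s \<in> span S" using c s_def by simp
      have cb: "\<bar>c\<bar> \<le> norm x / d" using le[OF s, of c] d x by (simp add: field_simps)
      have ns: "norm s \<le> norm x + norm x / d * norm v"
      proof -
        have "norm s \<le> norm x + \<bar>c\<bar> * norm v"
          using norm_triangle_ineq4[of x "c *\<^sub>R v"] by (simp add: s_def)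
        then show ?thesis using mult_right_mono[OF cb, of "norm v"] by simp
      qed
      have "norm (f x) \<le> norm (f s) + \<bar>c\<bar> * norm (f v)"
        using norm_triangle_ineq[of "f s" "c *\<^sub>R f v"]
        by (simp add: x linear_add[OF f] linear_scale[OF f])
      also have "norm (f s) \<le> K * norm s" by (rule K[OF s])
      also have "\<dots> \<le> \<bar>K\<bar> * norm s" by (simp add: mult_right_mono)
      also have "\<dots> \<le> \<bar>K\<bar> * (norm x + norm x / d * norm v)" using ns by (simp add: mult_left_mono)
      also have "\<bar>c\<bar> * norm (f v) \<le> norm x / d * norm (f v)"
        by (rule mult_right_mono[OF cb]) simp
      finally show ?thesis by (simp add: L_def algebra_simps add_divide_distrib)
    qed
    then show ?thesis by blast
  qed
qed

lemma linear_imp_bounded_linear_fin_dim: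
  fixes f :: "'a::real_normed_vector \<Rightarrow> 'b::real_normed_vector"
  assumes "finite S" "span S = (UNIV :: 'a set)" "linear f"
  shows "bounded_linear f"
proof -
  obtain K where K: "\<forall>x\<in>span S. norm (f x) \<le> K * norm x"
    using linear_bounded_on_span_finite[OF assms(1,3)] by blast
  show ?thesis
    by (intro bounded_linear_intro[where K = K])
       (use K assms(2) in \<open>auto simp: linear_add[OF assms(3)] linear_scale[OF assms(3)] mult.commute\<close>)
qed

text \<open>
  Closedness of all subspaces makes the closure argument for differentiable orbits work: a
  property that cuts out a subspace and holds on a dense set holds everywhere.
\<close>

lemma closed_subspace_fin_dim:
  fixes S D :: "'a::real_normed_vector set"
  assumes "finite S" "span S = UNIV" "subspace D"
  shows "closed D"
proof -
  obtain B where B: "B \<subseteq> D" "independent B" "D \<subseteq> span B"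
    using maximal_independent_subset by blast
  then have "finite B" using real_vector.independent_span_bound[OF assms(1) B(2)] assms(2) by auto
  moreover have "span B = D"
    using B(1,3) assms(3) span_minimal by blast
  ultimately show ?thesis using complete_span_finite complete_imp_closed by metis
qed

text \<open>
  Coordinates with respect to a finite basis \<open>B\<close> are bounded functionals. They reduce integrals
  and power series of vectors to the real line, where completeness is part of the type.
\<close>

lemma coordinates_fin_dim:
  fixes S :: "'a::real_normed_vector set"
  assumes "finite S" "span S = UNIV"
  obtains B and f :: "'a \<Rightarrow> 'a \<Rightarrow> real" where
    "finite B" "\<And>b. bounded_linear (f b)" "\<And>x. (\<Sum>b\<in>B. f b x *\<^sub>R b) = x"
proof -
  obtain B :: "'a set" where B: "independent B" "UNIV \<subseteq> span B"
    by (rule maximal_independent_subset[of UNIV])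
  have fin: "finite B" using real_vector.independent_span_bound[OF assms(1) B(1)] assms(2) by auto
  have in_span: "x \<in> span B" for x using B(2) by auto
  show ?thesis
  proof
    show "finite B" by (rule fin)
    show "bounded_linear (\<lambda>x. representation B x b)" for b
      by (intro linear_imp_bounded_linear_fin_dim[OF assms] linearI)
         (simp_all add: representation_add representation_scale B(1) in_span)
    show "(\<Sum>b\<in>B. representation B x b *\<^sub>R b) = x" for x
      by (rule sum_representation_eq[OF B(1) in_span fin subset_refl])
  qed
qed

section \<open>The exponential of a linear operator\<close>

lemma has_vector_derivative_at_0_iff:
  fixes f :: "real \<Rightarrow> 'a::real_normed_vector"
  shows "(f has_vector_derivative f') (at 0) \<longleftrightarrow> ((\<lambda>t. (f t - f 0) /\<^sub>R t) \<longlongrightarrow> f') (at 0)"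
proof -
  have "norm ((f t - f 0) /\<^sub>R t - f') = norm (f t - f 0 - t *\<^sub>R f') / norm t" if "t \<noteq> 0" for t
  proof -
    have "(f t - f 0) /\<^sub>R t - f' = (f t - f 0 - t *\<^sub>R f') /\<^sub>R t"
      using that by (simp add: algebra_simps)
    then show ?thesis by (simp add: divide_inverse mult.commute)
  qed
  then have "((\<lambda>t. norm (f t - f 0 - t *\<^sub>R f') / norm t) \<longlongrightarrow> 0) (at 0)
      \<longleftrightarrow> ((\<lambda>t. norm ((f t - f 0) /\<^sub>R t - f')) \<longlongrightarrow> 0) (at 0)"
    by (intro filterlim_cong) (auto simp: eventually_at_filter)
  also have "\<dots> \<longleftrightarrow> ((\<lambda>t. (f t - f 0) /\<^sub>R t) \<longlongrightarrow> f') (at 0)"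
    by (simp only: tendsto_norm_zero_iff LIM_zero_iff)
  finally show ?thesis
    by (simp add: has_vector_derivative_def has_derivative_iff_norm bounded_linear_scaleR_left)
qed

lemma funpow_scaleR_linear:
  fixes A :: "'a::real_vector \<Rightarrow> 'a"
  assumes "linear A"
  shows "((\<lambda>x. t *\<^sub>R A x) ^^ n) x = t ^ n *\<^sub>R (A ^^ n) x"
  by (induction n) (simp_all add: linear_scale[OF assms])

lemma norm_funpow_le:
  fixes A :: "'a::real_normed_vector \<Rightarrow> 'a"
  assumes "K \<ge> 0" "\<And>x. norm (A x) \<le> K * norm x"
  shows "norm ((A ^^ n) x) \<le> K ^ n * norm x"
proof (induction n)
  case (Suc n)
  have "norm ((A ^^ Suc n) x) \<le> K * norm ((A ^^ n) x)" using assms(2) by simp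
  also have "\<dots> \<le> K * (K ^ n * norm x)" using Suc assms(1) by (rule mult_left_mono)
  finally show ?case by (simp add: mult.assoc)
qed simp

text \<open>
  In coordinates, \<open>t \<mapsto> e\<^sup>t\<^sup>A x\<close> is a finite family of everywhere convergent real power series in
  \<open>t\<close>; their linear coefficients are the coordinates of \<open>A x\<close>. The derivative at zero recovers
  \<open>A\<close> from the exponential, which gives uniqueness of the generator.
\<close>

lemma op_exp_fin_dim:
  fixes S :: "'a::real_normed_vector set" and A :: "'a::real_normed_vector \<Rightarrow> 'a"
  assumes S: "finite S" "span S = UNIV" and A: "linear A"
  shows op_exp_sums: "(\<lambda>n. ((\<lambda>x. t *\<^sub>R A x) ^^ n) x /\<^sub>R fact n) sums op_exp (\<lambda>x. t *\<^sub>R A x) x"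
    and op_exp_derivative_at_0:
      "((\<lambda>t. op_exp (\<lambda>x. t *\<^sub>R A x) x) has_vector_derivative A x) (at 0)"
proof -
  obtain B and f :: "'a \<Rightarrow> 'a \<Rightarrow> real" where B: "finite B"
    and f: "\<And>b. bounded_linear (f b)" and rep: "\<And>x. (\<Sum>b\<in>B. f b x *\<^sub>R b) = x"
    using coordinates_fin_dim[OF S] by metis
  have blA: "bounded_linear A" by (rule linear_imp_bounded_linear_fin_dim[OF S A])
  then obtain K where K: "K \<ge> 0" "\<And>x. norm (A x) \<le> norm x * K"
    using bounded_linear.nonneg_bounded by blast
  define a where "a b n = f b ((A ^^ n) x) / fact n" for b n
  have summ: "summable (\<lambda>n. a b n * t ^ n)" for b t
  proof -
    obtain C where C: "C \<ge> 0" "\<And>x. norm (f b x) \<le> norm x * C"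
      using bounded_linear.nonneg_bounded[OF f] by blast
    have "summable (\<lambda>n. C * norm x * (inverse (fact n) * (K * \<bar>t\<bar>) ^ n))"
      by (intro summable_mult summable_exp)
    then show ?thesis
    proof (rule summable_comparison_test'[where N = 0])
      fix n
      have "\<bar>f b ((A ^^ n) x)\<bar> \<le> C * norm ((A ^^ n) x)" using C(2) by (simp add: mult.commute)
      also have "\<dots> \<le> C * (K ^ n * norm x)"
        using C(1) norm_funpow_le[of K A n x] K by (simp add: mult_left_mono mult.commute)
      finally have "\<bar>f b ((A ^^ n) x)\<bar> * (inverse (fact n) * \<bar>t\<bar> ^ n)
          \<le> C * (K ^ n * norm x) * (inverse (fact n) * \<bar>t\<bar> ^ n)"
        by (rule mult_right_mono) simp
      then show "norm (a b n * t ^ n) \<le> C * norm x * (inverse (fact n) * (K * \<bar>t\<bar>) ^ n)"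
        by (simp add: a_def abs_mult power_abs divide_inverse power_mult_distrib mult_ac)
    qed
  qed
  have vec: "(\<Sum>b\<in>B. (a b n * t ^ n) *\<^sub>R b) = ((\<lambda>x. t *\<^sub>R A x) ^^ n) x /\<^sub>R fact n" for t n
  proof -
    have "(\<Sum>b\<in>B. (a b n * t ^ n) *\<^sub>R b) = (t ^ n / fact n) *\<^sub>R (\<Sum>b\<in>B. f b ((A ^^ n) x) *\<^sub>R b)"
      by (simp add: scaleR_sum_right a_def mult.commute)
    then show ?thesis by (simp add: rep funpow_scaleR_linear[OF A] divide_inverse mult.commute)
  qed
  have sums: "(\<lambda>n. ((\<lambda>x. t *\<^sub>R A x) ^^ n) x /\<^sub>R fact n) sums (\<Sum>b\<in>B. (\<Sum>n. a b n * t ^ n) *\<^sub>R b)" for t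
    unfolding vec[symmetric] by (intro sums_sum sums_scaleR_left summable_sums summ)
  then have eq: "op_exp (\<lambda>x. t *\<^sub>R A x) x = (\<Sum>b\<in>B. (\<Sum>n. a b n * t ^ n) *\<^sub>R b)" for t
    unfolding op_exp_def by (simp add: sums_iff)
  show "(\<lambda>n. ((\<lambda>x. t *\<^sub>R A x) ^^ n) x /\<^sub>R fact n) sums op_exp (\<lambda>x. t *\<^sub>R A x) x"
    using sums eq by simp
  have "((\<lambda>t. \<Sum>b\<in>B. (\<Sum>n. a b n * t ^ n) *\<^sub>R b) has_vector_derivative
      (\<Sum>b\<in>B. f b (A x) *\<^sub>R b)) (at 0)"
  proof (intro has_vector_derivative_sum bounded_linear.has_vector_derivative
        [OF bounded_linear_scaleR_left])
    fix b
    have "((\<lambda>t. \<Sum>n. a b n * t ^ n) has_field_derivative (\<Sum>n. diffs (a b) n * 0 ^ n)) (at 0)"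
      by (rule termdiffs_strong_converges_everywhere[OF summ])
    moreover have "diffs (a b) 0 = f b (A x)" by (simp add: diffs_def a_def)
    ultimately show "((\<lambda>t. \<Sum>n. a b n * t ^ n) has_vector_derivative f b (A x)) (at 0)"
      by (simp only: has_real_derivative_iff_has_vector_derivative powser_zero)
  qed
  then show "((\<lambda>t. op_exp (\<lambda>x. t *\<^sub>R A x) x) has_vector_derivative A x) (at 0)"
    by (simp add: eq rep)
qed

section \<open>The generator of a linear flow\<close>

definition velocity :: "(real \<Rightarrow> 'a::real_normed_vector \<Rightarrow> 'a) \<Rightarrow> 'a \<Rightarrow> 'a"
  where "velocity \<Phi> x = vector_derivative (\<lambda>t. \<Phi> t x) (at 0)"

text \<open>
  A linear flow seen over the reals, whatever the scalar field is. The finite spanning set \<open>S\<close>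
  is a parameter because finite dimension is a hypothesis here and not a property of the type.
\<close>

locale fin_dim_flow =
  fixes \<Phi> :: "real \<Rightarrow> 'a::real_normed_vector \<Rightarrow> 'a" and S :: "'a set"
  assumes fin: "finite S" and span: "span S = UNIV"
    and lin: "linear (\<Phi> t)" and flow: "flow \<Phi>"
begin

lemma bounded_linear_flow: "bounded_linear (\<Phi> t)"
  by (rule linear_imp_bounded_linear_fin_dim[OF fin span lin])

lemma flow_flow: "\<Phi> t (\<Phi> s x) = \<Phi> (t + s) x" and flow_0 [simp]: "\<Phi> 0 x = x"
  using flow by (auto simp: flow_def)

lemma continuous_on_orbit: "continuous_on T (\<lambda>t. \<Phi> t x)"
proof -
  have "continuous_on UNIV (\<lambda>(t, x). \<Phi> t x)" using flow by (simp add: flow_def)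
  then have "continuous_on T ((\<lambda>(t, x). \<Phi> t x) \<circ> (\<lambda>t. (t, x)))"
    by (intro continuous_on_compose continuous_intros) (auto elim: continuous_on_subset)
  then show ?thesis by (simp add: o_def)
qed

text \<open>
  Times from \<open>[0, 1]\<close> shifted by less than one stay inside \<open>(-2, 2)\<close>, which is all that the
  averages below require.
\<close>

lemma local_antiderivative:
  obtains W where "\<And>u. u \<in> {-2<..<2} \<Longrightarrow> (W has_vector_derivative \<Phi> u x) (at u)"
proof -
  obtain B and f :: "'a \<Rightarrow> 'a \<Rightarrow> real" where B: "finite B"
    and f: "\<And>b. bounded_linear (f b)" and rep: "\<And>x. (\<Sum>b\<in>B. f b x *\<^sub>R b) = x"
    using coordinates_fin_dim[OF fin span] by metis
  have "\<exists>g. \<forall>u\<in>{-2..2}. (g has_vector_derivative f b (\<Phi> u x)) (at u within {-2..2})" for b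
    using antiderivative_continuous[of "-2" 2 "\<lambda>u. f b (\<Phi> u x)"]
      bounded_linear.continuous_on[OF f continuous_on_orbit] by metis
  then obtain g where g: "\<And>b u. u \<in> {-2..2} \<Longrightarrow>
      (g b has_vector_derivative f b (\<Phi> u x)) (at u within {-2..2})"
    by metis
  have "((\<lambda>u. \<Sum>b\<in>B. g b u *\<^sub>R b) has_vector_derivative (\<Sum>b\<in>B. f b (\<Phi> u x) *\<^sub>R b)) (at u)"
    if "u \<in> {-2<..<2}" for u
    using that g[of u]
    by (intro has_vector_derivative_sum bounded_linear.has_vector_derivative
        [OF bounded_linear_scaleR_left]) (auto simp: at_within_Icc_at)
  then show thesis by (intro that[of "\<lambda>u. \<Sum>b\<in>B. g b u *\<^sub>R b"]) (simp add: rep)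
qed

text \<open>
  Averaging an orbit makes it differentiable: \<open>w = \<integral>\<^sub>0\<^sup>t \<Phi>\<^sub>s x ds\<close> satisfies \<open>\<Phi>\<^sub>h w = \<integral>\<^sub>h\<^sup>t\<^sup>+\<^sup>h \<Phi>\<^sub>s x
  ds\<close>, which is differentiable in \<open>h\<close> by the fundamental theorem of calculus. The points with a
  differentiable orbit form a subspace, hence a closed set, and the averages \<open>w / t\<close> converge to
  \<open>x\<close> as \<open>t\<close> tends to zero.
\<close>

lemma orbit_differentiable_at_0: "\<exists>v. ((\<lambda>t. \<Phi> t x) has_vector_derivative v) (at 0)"
proof -
  define D where "D = {w. \<exists>v. ((\<lambda>t. \<Phi> t w) has_vector_derivative v) (at 0)}"
  have "subspace D"
    unfolding subspace_def D_def
    by (auto simp: linear_add[OF lin] linear_scale[OF lin] linear_0[OF lin]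
        intro: has_vector_derivative_add has_vector_derivative_const
          bounded_linear.has_vector_derivative[OF bounded_linear_scaleR_right])
  then have cl: "closed D" by (rule closed_subspace_fin_dim[OF fin span])
  obtain W where W: "\<And>u. u \<in> {-2<..<2} \<Longrightarrow> (W has_vector_derivative \<Phi> u x) (at u)"
    using local_antiderivative by blast
  have shift: "\<Phi> h (W t - W 0) = W (t + h) - W h" if t: "0 < t" "t < 1" and h: "\<bar>h\<bar> < 1" for t h
  proof -
    \<comment> \<open>In terms of an antiderivative \<open>W\<close> of the orbit, both sides have derivative \<open>\<Phi>\<^sub>s\<^sub>+\<^sub>h x\<close> in the upper
    limit of integration; this replaces moving \<open>\<Phi>\<^sub>h\<close> under an integral sign.\<close>
    have der: "((\<lambda>s. \<Phi> h (W s) - W (s + h)) has_vector_derivative 0) (at s)" if "s \<in> {0..t}" for s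
    proof -
      have "((W \<circ> (\<lambda>s. s + h)) has_vector_derivative 1 *\<^sub>R \<Phi> (s + h) x) (at s)"
        using that t h by (intro vector_diff_chain_at W) (auto intro!: derivative_eq_intros)
      moreover have "((\<lambda>s. \<Phi> h (W s)) has_vector_derivative \<Phi> h (\<Phi> s x)) (at s)"
        using that t by (intro bounded_linear.has_vector_derivative[OF bounded_linear_flow] W) auto
      ultimately show ?thesis
        using has_vector_derivative_diff by (fastforce simp: flow_flow o_def add.commute)
    qed
    have "\<exists>c. \<forall>s\<in>{0..t}. \<Phi> h (W s) - W (s + h) = c"
      by (rule has_derivative_zero_constant)
         (use has_vector_derivative_at_within[OF der] in \<open>auto simp: has_vector_derivative_def\<close>)
    then have "\<Phi> h (W t) - W (t + h) = \<Phi> h (W 0) - W (0 + h)" using t by force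
    then show ?thesis by (simp add: linear_diff[OF lin] algebra_simps)
  qed
  have "W t - W 0 \<in> D" if t: "0 < t" "t < 1" for t
  proof -
    have "((W \<circ> (\<lambda>h. t + h)) has_vector_derivative 1 *\<^sub>R \<Phi> (t + 0) x) (at 0)"
      using t by (intro vector_diff_chain_at W) (auto intro!: derivative_eq_intros)
    then have "((\<lambda>h. W (t + h) - W h) has_vector_derivative \<Phi> t x - \<Phi> 0 x) (at 0)"
      using W[of 0] by (intro has_vector_derivative_diff) (auto simp: o_def)
    then have "((\<lambda>h. \<Phi> h (W t - W 0)) has_vector_derivative \<Phi> t x - \<Phi> 0 x) (at 0)"
      by (rule has_vector_derivative_transform_within_open[of _ _ _ "{-1<..<1}"])
         (use shift[OF t] in auto)
    then show ?thesis by (auto simp: D_def)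
  qed
  then have "(W t - W 0) /\<^sub>R t \<in> D" if "0 < t" "t < 1" for t
    using that \<open>subspace D\<close> by (intro subspace_scale)
  then have "eventually (\<lambda>t. (W t - W 0) /\<^sub>R t \<in> D) (at_right 0)"
    by (auto simp: eventually_at_right_field intro!: exI[of _ 1])
  moreover have "((\<lambda>t. (W t - W 0) /\<^sub>R t) \<longlongrightarrow> x) (at_right 0)"
    using W[of 0] by (auto simp: has_vector_derivative_at_0_iff intro: filterlim_at_split[THEN iffD1, THEN conjunct2])
  ultimately have "x \<in> D"
    by (intro Lim_in_closed_set[OF cl]) auto
  then show ?thesis by (simp add: D_def)
qed

lemma velocity_derivative_at_0: "((\<lambda>t. \<Phi> t x) has_vector_derivative velocity \<Phi> x) (at 0)"
  using orbit_differentiable_at_0[of x] by (auto simp: velocity_def vector_derivative_at)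

lemma velocity_eqI: "((\<lambda>t. \<Phi> t x) has_vector_derivative v) (at 0) \<Longrightarrow> velocity \<Phi> x = v"
  by (simp add: velocity_def vector_derivative_at)

lemma linear_velocity: "linear (velocity \<Phi>)"
proof (rule linearI)
  show "velocity \<Phi> (x + y) = velocity \<Phi> x + velocity \<Phi> y" for x y
    by (rule velocity_eqI)
       (auto simp: linear_add[OF lin] intro!: has_vector_derivative_add velocity_derivative_at_0)
  show "velocity \<Phi> (r *\<^sub>R x) = r *\<^sub>R velocity \<Phi> x" for r x
    by (rule velocity_eqI)
       (auto simp: linear_scale[OF lin]
         intro!: bounded_linear.has_vector_derivative[OF bounded_linear_scaleR_right]
           velocity_derivative_at_0)
qed

lemma bounded_linear_velocity: "bounded_linear (velocity \<Phi>)"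
  by (rule linear_imp_bounded_linear_fin_dim[OF fin span linear_velocity])

lemma orbit_derivative: "((\<lambda>t. \<Phi> t x) has_vector_derivative \<Phi> t (velocity \<Phi> x)) (at t)"
proof -
  have "((\<lambda>s. \<Phi> t (\<Phi> s x)) has_vector_derivative \<Phi> t (velocity \<Phi> x)) (at (t - t))"
    using bounded_linear.has_vector_derivative[OF bounded_linear_flow velocity_derivative_at_0] by simp
  then have "((\<lambda>s. \<Phi> t (\<Phi> s x)) \<circ> (\<lambda>s. s - t) has_vector_derivative 1 *\<^sub>R \<Phi> t (velocity \<Phi> x)) (at t)"
    by (intro vector_diff_chain_at) (auto intro!: derivative_eq_intros)
  then show ?thesis by (simp add: o_def flow_flow)
qed

text \<open>
  The \<open>n\<close>-th derivative of \<open>t \<mapsto> \<Phi>\<^sub>t x\<close> is \<open>\<Phi>\<^sub>t A\<^sup>n x\<close>, which for bounded times grows at most like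
  \<open>K\<^sup>n\<close> if \<open>K\<close> is a bound for \<open>A\<close>. Therefore the Taylor series at zero of every coordinate
  converges to that coordinate, and this series is the exponential series.
\<close>

lemma flow_eq_op_exp: "\<Phi> t = op_exp (\<lambda>x. t *\<^sub>R velocity \<Phi> x)"
proof
  fix x
  let ?A = "velocity \<Phi>"
  obtain B and f :: "'a \<Rightarrow> 'a \<Rightarrow> real" where B: "finite B"
    and f: "\<And>b. bounded_linear (f b)" and rep: "\<And>x. (\<Sum>b\<in>B. f b x *\<^sub>R b) = x"
    using coordinates_fin_dim[OF fin span] by metis
  obtain K where K: "K \<ge> 0" "\<And>x. norm (?A x) \<le> norm x * K"
    using bounded_linear.nonneg_bounded[OF bounded_linear_velocity] by blast
  obtain C where C: "\<And>b. C b \<ge> 0" "\<And>b x. norm (f b x) \<le> norm x * C b"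
    using bounded_linear.nonneg_bounded[OF f] by metis
  have sums: "(\<lambda>n. f b ((?A ^^ n) x) / fact n * t ^ n) sums f b (\<Phi> t x)" for b
  proof -
    define diff where "diff m s = f b (\<Phi> s ((?A ^^ m) x))" for m s
    have der: "DERIV (diff m) s :> diff (Suc m) s" for m s
      using bounded_linear.has_vector_derivative[OF f orbit_derivative, of b "(?A ^^ m) x" s]
      by (simp add: diff_def[abs_def] has_real_derivative_iff_has_vector_derivative)
    \<comment> \<open>A bound on \<open>\<Phi>\<^sub>s\<close> that is uniform in \<open>s\<close> comes from compactness of the time interval,
    one basis vector at a time.\<close>
    have "\<exists>M\<ge>0. \<forall>s. \<bar>s\<bar> \<le> \<bar>t\<bar> \<longrightarrow> \<bar>f b (\<Phi> s c)\<bar> \<le> M" for c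
    proof -
      have "compact ((\<lambda>s. f b (\<Phi> s c)) ` {-\<bar>t\<bar>..\<bar>t\<bar>})"
        by (intro compact_continuous_image bounded_linear.continuous_on[OF f] continuous_on_orbit compact_Icc)
      then have "bounded ((\<lambda>s. f b (\<Phi> s c)) ` {-\<bar>t\<bar>..\<bar>t\<bar>})" by (rule compact_imp_bounded)
      then obtain M where "\<forall>s\<in>{-\<bar>t\<bar>..\<bar>t\<bar>}. \<bar>f b (\<Phi> s c)\<bar> \<le> M"
        unfolding bounded_iff by auto
      then show ?thesis by (intro exI[of _ "max M 0"]) (auto simp: abs_le_iff le_max_iff_disj)
    qed
    then obtain M where M: "\<And>c. M c \<ge> 0" "\<And>c s. \<bar>s\<bar> \<le> \<bar>t\<bar> \<Longrightarrow> \<bar>f b (\<Phi> s c)\<bar> \<le> M c" by metis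
    define L where "L = (\<Sum>c\<in>B. C c * M c)"
    have L0: "L \<ge> 0" unfolding L_def using C(1) M(1) by (intro sum_nonneg) simp
    have L: "\<bar>f b (\<Phi> s y)\<bar> \<le> L * norm y" if "\<bar>s\<bar> \<le> \<bar>t\<bar>" for s y
    proof -
      interpret g: bounded_linear "\<lambda>y. f b (\<Phi> s y)"
        using bounded_linear_compose[OF f bounded_linear_flow] by simp
      have "f b (\<Phi> s y) = (\<Sum>c\<in>B. f c y * f b (\<Phi> s c))"
        using g.sum[of "\<lambda>c. f c y *\<^sub>R c" B] by (simp add: rep g.scaleR)
      also have "\<bar>\<dots>\<bar> \<le> (\<Sum>c\<in>B. (norm y * C c) * M c)"
        unfolding abs_mult
        by (rule order_trans[OF sum_abs], rule sum_mono, unfold abs_mult, rule mult_mono)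
           (use C M that in auto)
      also have "\<dots> = L * norm y" by (simp add: L_def sum_distrib_left mult_ac)
      finally show ?thesis .
    qed
    have rem: "norm ((\<Sum>m<n. f b ((?A ^^ m) x) / fact m * t ^ m) - f b (\<Phi> t x))
        \<le> L * norm x * (inverse (fact n) * (K * \<bar>t\<bar>) ^ n)" for n
    proof -
      obtain s where s: "\<bar>s\<bar> \<le> \<bar>t\<bar>"
        "diff 0 t = (\<Sum>m<n. diff m 0 / fact m * t ^ m) + diff n s / fact n * t ^ n"
        using Maclaurin_bi_le[of diff "diff 0" n t] der by blast
      have "\<bar>diff n s\<bar> \<le> L * norm ((?A ^^ n) x)" using L[OF s(1)] by (simp add: diff_def)
      also have "\<dots> \<le> L * (K ^ n * norm x)"
        using L0 norm_funpow_le[of K ?A n x] K by (simp add: mult_left_mono mult.commute)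
      finally have "\<bar>diff n s\<bar> * (inverse (fact n) * \<bar>t\<bar> ^ n)
          \<le> L * (K ^ n * norm x) * (inverse (fact n) * \<bar>t\<bar> ^ n)"
        by (rule mult_right_mono) simp
      moreover have "norm ((\<Sum>m<n. f b ((?A ^^ m) x) / fact m * t ^ m) - f b (\<Phi> t x))
          = \<bar>diff n s\<bar> * (inverse (fact n) * \<bar>t\<bar> ^ n)"
        using s(2) by (simp add: diff_def abs_mult power_abs divide_inverse)
      ultimately show ?thesis by (simp add: power_mult_distrib mult_ac)
    qed
    have "(\<lambda>n. L * norm x * (inverse (fact n) * (K * \<bar>t\<bar>) ^ n)) \<longlonglongrightarrow> 0"
      by (intro tendsto_mult_right_zero summable_LIMSEQ_zero summable_exp)
    then have "(\<lambda>n. (\<Sum>m<n. f b ((?A ^^ m) x) / fact m * t ^ m) - f b (\<Phi> t x)) \<longlonglongrightarrow> 0"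
      by (rule Lim_null_comparison[OF always_eventually[OF allI[OF rem]]])
    then show ?thesis unfolding sums_def by (simp add: LIM_zero_iff)
  qed
  have "(\<lambda>n. \<Sum>b\<in>B. (f b ((?A ^^ n) x) / fact n * t ^ n) *\<^sub>R b) sums (\<Sum>b\<in>B. f b (\<Phi> t x) *\<^sub>R b)"
    by (intro sums_sum sums_scaleR_left sums)
  moreover have "(\<Sum>b\<in>B. (f b ((?A ^^ n) x) / fact n * t ^ n) *\<^sub>R b)
      = ((\<lambda>x. t *\<^sub>R ?A x) ^^ n) x /\<^sub>R fact n" for n
  proof -
    have "(\<Sum>b\<in>B. (f b ((?A ^^ n) x) / fact n * t ^ n) *\<^sub>R b)
        = (t ^ n / fact n) *\<^sub>R (\<Sum>b\<in>B. f b ((?A ^^ n) x) *\<^sub>R b)"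
      by (simp add: scaleR_sum_right mult.commute)
    then show ?thesis
      by (simp add: rep funpow_scaleR_linear[OF linear_velocity] divide_inverse mult.commute)
  qed
  ultimately show "\<Phi> t x = op_exp (\<lambda>x. t *\<^sub>R ?A x) x"
    by (simp add: op_exp_def rep sums_iff)
qed

end

lemma (in fin_dim_flow) velocity_eq_0_iff: "velocity \<Phi> x = 0 \<longleftrightarrow> (\<forall>t. \<Phi> t x = x)"
proof
  assume "velocity \<Phi> x = 0"
  then have "((\<lambda>t. \<Phi> t x) has_vector_derivative 0) (at t)" for t
    using orbit_derivative[of x t] by (simp add: linear_0[OF lin])
  then have "\<exists>c. \<forall>t\<in>UNIV. \<Phi> t x = c"
    by (intro has_derivative_zero_constant) (simp_all add: has_vector_derivative_def)
  then show "\<forall>t. \<Phi> t x = x" using flow_0 by (metis UNIV_I)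
next
  assume "\<forall>t. \<Phi> t x = x"
  then show "velocity \<Phi> x = 0" by (intro velocity_eqI) simp
qed

section \<open>Velocities under an orbit equivalence\<close>

text \<open>
  The factors converge because, where \<open>q t \<noteq> 0\<close>, they are the quotients of the norms.
\<close>

lemma limit_of_nonneg_multiples:
  fixes p q :: "'c \<Rightarrow> 'a::real_normed_vector"
  assumes p: "(p \<longlongrightarrow> P) F" and q: "(q \<longlongrightarrow> Q) F" and "F \<noteq> bot" and "Q \<noteq> 0"
    and mult: "eventually (\<lambda>t. \<exists>c\<ge>0. p t = c *\<^sub>R q t) F"
  shows "\<exists>c\<ge>0. P = c *\<^sub>R Q"
proof -
  have "((\<lambda>t. (norm (p t) / norm (q t)) *\<^sub>R q t) \<longlongrightarrow> (norm P / norm Q) *\<^sub>R Q) F"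
    using \<open>Q \<noteq> 0\<close> by (intro tendsto_intros p q) simp
  moreover have "eventually (\<lambda>t. (norm (p t) / norm (q t)) *\<^sub>R q t = p t) F"
    using mult tendsto_imp_eventually_ne[OF q \<open>Q \<noteq> 0\<close>] by eventually_elim auto
  ultimately have "(p \<longlongrightarrow> (norm P / norm Q) *\<^sub>R Q) F"
    by (rule Lim_transform_eventually)
  then have "P = (norm P / norm Q) *\<^sub>R Q" using tendsto_unique[OF \<open>F \<noteq> bot\<close> p] by blast
  then show ?thesis by (intro exI[of _ "norm P / norm Q"]) simp
qed

lemma strict_mono_right_limit:
  fixes \<tau> :: "real \<Rightarrow> real"
  assumes "strict_mono \<tau>"
  obtains s where "(\<tau> \<longlongrightarrow> s) (at_right 0)" "\<And>t. t > 0 \<Longrightarrow> s < \<tau> t"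
proof -
  define s where "s = Inf (\<tau> ` {0<..})"
  have bdd: "bdd_below (\<tau> ` {0<..})"
    using strict_mono_less[OF assms] by (intro bdd_belowI[of _ "\<tau> 0"]) (auto intro: less_imp_le)
  have le: "s \<le> \<tau> t" if "t > 0" for t unfolding s_def using that bdd by (intro cInf_lower) auto
  show thesis
  proof
    show "s < \<tau> t" if "t > 0" for t
      using le[of "t / 2"] that strict_mono_less[OF assms, of "t / 2" t] by simp
    show "(\<tau> \<longlongrightarrow> s) (at_right 0)"
    proof (rule order_tendstoI)
      fix a assume "a < s"
      then show "eventually (\<lambda>t. a < \<tau> t) (at_right 0)"
        using le by (auto simp: eventually_at_right_field intro!: exI[of _ 1] intro: less_le_trans)
    next
      fix a assume "s < a"
      then obtain u where u: "u > 0" "\<tau> u < a"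
        using cInf_lessD[of "\<tau> ` {0<..}" a] unfolding s_def by (auto intro: greaterThan_iff)
      then show "eventually (\<lambda>t. \<tau> t < a) (at_right 0)"
        using strict_mono_less[OF assms]
        by (auto simp: eventually_at_right_field intro!: exI[of _ u] intro: less_trans)
    qed
  qed
qed

text \<open>
  The time change \<open>\<tau>\<close> may jump, but it is monotone and so has a limit \<open>s\<close> from the right at
  zero. Continuity of both orbits forces \<open>\<Psi>\<^sub>s\<close> to fix \<open>h x\<close>, and subtracting \<open>s\<close> yields a time
  change that is positive and tends to zero.
\<close>

lemma orbit_reparametrization_near_0:
  assumes "fin_dim_flow \<Phi> S" "fin_dim_flow \<Psi> T"
    and h: "isCont h x" and \<tau>: "strict_mono \<tau>" and conj: "\<And>t. h (\<Phi> t x) = \<Psi> (\<tau> t) (h x)"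
  obtains \<sigma> :: "real \<Rightarrow> real" where
    "filterlim \<sigma> (at 0) (at_right 0)" "\<And>t. t > 0 \<Longrightarrow> \<sigma> t > 0"
    "\<And>t. h (\<Phi> t x) = \<Psi> (\<sigma> t) (h x)"
proof -
  interpret X: fin_dim_flow \<Phi> S by fact
  interpret Y: fin_dim_flow \<Psi> T by fact
  obtain s where s: "(\<tau> \<longlongrightarrow> s) (at_right 0)" "\<And>t. t > 0 \<Longrightarrow> s < \<tau> t"
    using strict_mono_right_limit[OF \<tau>] by blast
  have "isCont (\<lambda>t. \<Phi> t x) 0"
    using X.continuous_on_orbit[of UNIV x] by (simp add: continuous_on_eq_continuous_at)
  then have "((\<lambda>t. \<Phi> t x) \<longlongrightarrow> x) (at_right 0)"
    by (simp add: isCont_def filterlim_at_split)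
  then have "((\<lambda>t. h (\<Phi> t x)) \<longlongrightarrow> h x) (at_right 0)"
    by (rule isCont_tendsto_compose[OF h])
  moreover have "isCont (\<lambda>s. \<Psi> s (h x)) s"
    using Y.continuous_on_orbit[of UNIV "h x"] by (simp add: continuous_on_eq_continuous_at)
  then have "((\<lambda>t. \<Psi> (\<tau> t) (h x)) \<longlongrightarrow> \<Psi> s (h x)) (at_right 0)"
    using s(1) by (rule isCont_tendsto_compose)
  ultimately have fixed: "\<Psi> s (h x) = h x"
    unfolding conj using tendsto_unique[OF trivial_limit_at_right_real] by blast
  show thesis
  proof
    have "((\<lambda>t. \<tau> t - s) \<longlongrightarrow> 0) (at_right 0)" using s(1) by (simp add: LIM_zero_iff)
    then show "filterlim (\<lambda>t. \<tau> t - s) (at 0) (at_right 0)"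
      using s(2) by (auto simp: filterlim_at eventually_at_right_field intro!: exI[of _ 1])
    show "\<tau> t - s > 0" if "t > 0" for t using s(2)[OF that] by simp
    show "h (\<Phi> t x) = \<Psi> (\<tau> t - s) (h x)" for t
      using Y.flow_flow[of "\<tau> t - s" s "h x"] by (simp add: fixed conj)
  qed
qed

text \<open>
  For \<open>t > 0\<close> the difference quotient of \<open>h (\<Phi>\<^sub>t x)\<close> over the time \<open>t\<close> is a positive multiple of
  that of \<open>\<Psi>\<^sub>s (h x)\<close> over the time \<open>s = \<sigma> t\<close>, and the two tend to the two sides of the claimed
  proportionality. The limit argument breaks down where the velocity at \<open>h x\<close> vanishes; there \<open>h
  x\<close> is an equilibrium, and injectivity of \<open>h\<close> makes \<open>x\<close> one, too.
\<close>

lemma orbit_equivalence_velocity: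
  assumes "fin_dim_flow \<Phi> S" "fin_dim_flow \<Psi> T"
    and h: "(h has_derivative h') (at x)" "inj h"
    and \<tau>: "strict_mono \<tau>" and conj: "\<And>t. h (\<Phi> t x) = \<Psi> (\<tau> t) (h x)"
  shows orbit_equivalence_velocity_zero: "velocity \<Phi> x = 0 \<longleftrightarrow> velocity \<Psi> (h x) = 0"
    and orbit_equivalence_velocity_direction:
      "\<exists>c\<ge>0. h' (velocity \<Phi> x) = c *\<^sub>R velocity \<Psi> (h x)"
proof -
  interpret X: fin_dim_flow \<Phi> S by fact
  interpret Y: fin_dim_flow \<Psi> T by fact
  obtain \<sigma> where \<sigma>: "filterlim \<sigma> (at 0) (at_right 0)" "\<And>t. t > 0 \<Longrightarrow> \<sigma> t > 0"
      "\<And>t. h (\<Phi> t x) = \<Psi> (\<sigma> t) (h x)"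
    using orbit_reparametrization_near_0[OF assms(1,2) has_derivative_continuous[OF h(1)] \<tau> conj]
    by metis
  let ?p = "\<lambda>t. (h (\<Phi> t x) - h x) /\<^sub>R t" and ?q = "\<lambda>t. (\<Psi> (\<sigma> t) (h x) - h x) /\<^sub>R \<sigma> t"
  have q: "(?q \<longlongrightarrow> velocity \<Psi> (h x)) (at_right 0)"
    using filterlim_compose[OF Y.velocity_derivative_at_0[of "h x",
        unfolded has_vector_derivative_at_0_iff] \<sigma>(1)] by simp
  show zero: "velocity \<Phi> x = 0 \<longleftrightarrow> velocity \<Psi> (h x) = 0"
  proof
    assume "velocity \<Phi> x = 0"
    then have "\<Psi> (\<sigma> t) (h x) = h x" for t using \<sigma>(3)[of t] by (simp add: X.velocity_eq_0_iff)
    then show "velocity \<Psi> (h x) = 0"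
      using q by (simp add: tendsto_const_iff)
  next
    assume "velocity \<Psi> (h x) = 0"
    then have "h (\<Phi> t x) = h x" for t by (simp add: Y.velocity_eq_0_iff conj)
    then show "velocity \<Phi> x = 0" using h(2) by (simp add: X.velocity_eq_0_iff inj_eq)
  qed
  show "\<exists>c\<ge>0. h' (velocity \<Phi> x) = c *\<^sub>R velocity \<Psi> (h x)"
  proof (cases "velocity \<Psi> (h x) = 0")
    case True
    then have "h' (velocity \<Phi> x) = 0"
      using zero linear_0[OF has_derivative_linear[OF h(1)]] by simp
    then show ?thesis by (auto intro: exI[of _ 0])
  next
    case False
    interpret h': bounded_linear h' using h(1) by (rule has_derivative_bounded_linear)
    have "(h has_derivative h') (at (\<Phi> 0 x))" using h(1) by simp
    then have "((\<lambda>t. h (\<Phi> t x)) has_derivative (\<lambda>t. h' (t *\<^sub>R velocity \<Phi> x))) (at 0)"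
      by (rule has_derivative_compose[OF X.velocity_derivative_at_0[unfolded has_vector_derivative_def]])
    then have "((\<lambda>t. h (\<Phi> t x)) has_vector_derivative h' (velocity \<Phi> x)) (at 0)"
      by (simp add: has_vector_derivative_def h'.scaleR)
    then have p: "(?p \<longlongrightarrow> h' (velocity \<Phi> x)) (at_right 0)"
      unfolding has_vector_derivative_at_0_iff by (auto simp: filterlim_at_split)
    have "\<exists>c\<ge>0. ?p t = c *\<^sub>R ?q t" if "t > 0" for t
      using \<sigma>(2)[OF that] that by (intro exI[of _ "\<sigma> t / t"]) (simp add: \<sigma>(3) field_simps)
    then show ?thesis
      by (intro limit_of_nonneg_multiples[OF p q trivial_limit_at_right_real False])
         (auto simp: eventually_at_right_field intro!: exI[of _ 1])
  qed
qed

section \<open>Linearization at the origin\<close>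

lemma has_derivative_along_line:
  assumes "(h has_derivative H) (at z)"
  shows "((\<lambda>\<epsilon>. (h (z + \<epsilon> *\<^sub>R v) - h z) /\<^sub>R \<epsilon>) \<longlongrightarrow> H v) (at_right 0)"
proof -
  interpret H: bounded_linear H using assms by (rule has_derivative_bounded_linear)
  have "(h has_derivative H) (at (z + 0 *\<^sub>R v))" using assms by simp
  then have "((\<lambda>\<epsilon>. h (z + \<epsilon> *\<^sub>R v)) has_derivative (\<lambda>\<epsilon>. H (\<epsilon> *\<^sub>R v))) (at 0)"
    by (rule has_derivative_compose[rotated]) (auto intro!: derivative_eq_intros)
  then have "((\<lambda>\<epsilon>. h (z + \<epsilon> *\<^sub>R v)) has_vector_derivative H v) (at 0)"
    by (simp add: has_vector_derivative_def H.scaleR)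
  then show ?thesis unfolding has_vector_derivative_at_0_iff by (auto simp: filterlim_at_split)
qed

text \<open>
  If \<open>h\<close> maps the kernel of \<open>A\<close> into the kernel of \<open>B\<close>, so does its derivative \<open>H\<close> at a point
  \<open>z\<close> of the kernel, since \<open>H v\<close> is a limit of multiples of differences of points \<open>h (z + \<epsilon> v)\<close>
  and \<open>h z\<close>.
\<close>

lemma derivative_maps_kernel:
  assumes A: "linear A" and B: "bounded_linear B"
    and h: "(h has_derivative H) (at z)" and ker: "\<And>x. A x = 0 \<Longrightarrow> B (h x) = 0"
    and "A z = 0" "A v = 0"
  shows "B (H v) = 0"
proof -
  interpret B: bounded_linear B by fact
  have "((\<lambda>\<epsilon>. B ((h (z + \<epsilon> *\<^sub>R v) - h z) /\<^sub>R \<epsilon>)) \<longlongrightarrow> B (H v)) (at_right 0)"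
    by (rule B.tendsto[OF has_derivative_along_line[OF h]])
  moreover have "B ((h (z + \<epsilon> *\<^sub>R v) - h z) /\<^sub>R \<epsilon>) = 0" for \<epsilon>
    using assms(5,6) by (simp add: B.scaleR B.diff ker linear_add[OF A] linear_scale[OF A])
  ultimately show ?thesis by (simp add: tendsto_const_iff)
qed

text \<open>
  The factor relating \<open>P v\<close> to \<open>Q v\<close> cannot depend on \<open>v\<close>: vectors whose images under \<open>Q\<close> are
  linearly independent have the same factor as their sum, and vectors with dependent images
  differ, after scaling, by an element of the common kernel.
\<close>

lemma linear_pointwise_proportional:
  fixes P Q :: "'a::real_vector \<Rightarrow> 'b::real_vector"
  assumes P: "linear P" and Q: "linear Q"
    and ker: "\<And>v. Q v = 0 \<Longrightarrow> P v = 0" and pos: "\<And>v. Q v \<noteq> 0 \<Longrightarrow> \<exists>c>0. P v = c *\<^sub>R Q v"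
  shows "\<exists>c>0. \<forall>v. P v = c *\<^sub>R Q v"
proof (cases "\<forall>v. Q v = 0")
  case True
  then show ?thesis using ker by (auto intro: exI[of _ 1])
next
  case False
  then obtain u where u: "Q u \<noteq> 0" by blast
  then obtain c where c: "c > 0" "P u = c *\<^sub>R Q u" using pos by blast
  have "P w = c *\<^sub>R Q w" for w
  proof (cases "\<exists>r. Q w = r *\<^sub>R Q u")
    case True
    then obtain r where r: "Q w = r *\<^sub>R Q u" by blast
    then have "P (w - r *\<^sub>R u) = 0"
      by (intro ker) (simp add: linear_diff[OF Q] linear_scale[OF Q])
    then show ?thesis
      by (simp add: linear_diff[OF P] linear_scale[OF P] c r mult.commute)
  next
    case False
    have "Q w \<noteq> 0" using False by (metis scaleR_zero_left)
    then obtain d where d: "P w = d *\<^sub>R Q w" using pos by blast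
    have "Q (u + w) \<noteq> 0"
      using False by (metis linear_add[OF Q] add_eq_0_iff scaleR_minus1_left)
    then obtain e where "P (u + w) = e *\<^sub>R Q (u + w)" using pos by blast
    then have eq: "(d - e) *\<^sub>R Q w = (e - c) *\<^sub>R Q u"
      by (simp add: linear_add[OF P] linear_add[OF Q] c d algebra_simps)
    have "d = e"
    proof (rule ccontr)
      assume "d \<noteq> e"
      then have "Q w = ((e - c) / (d - e)) *\<^sub>R Q u"
        using arg_cong[OF eq, of "\<lambda>x. x /\<^sub>R (d - e)"] by (simp add: divide_inverse mult.commute)
      then show False using False by blast
    qed
    then show ?thesis using eq u d by simp
  qed
  then show ?thesis using c(1) by blast
qed

text \<open>
  Write \<open>A\<close>, \<open>B\<close> for the velocity fields and \<open>H = Dh(0)\<close>. The origin is an equilibrium, so \<open>B (h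
  0) = 0\<close> and \<open>Dh(\<epsilon> v) A v\<close> is a nonnegative multiple of \<open>B (h (\<epsilon> v) - h 0) / \<epsilon>\<close>. As \<open>\<epsilon>\<close> tends
  to zero, continuity of \<open>Dh\<close> turns this into a relation between \<open>H A v\<close> and \<open>B H v\<close>. Since \<open>h\<close>
  and its inverse match equilibria, \<open>H A\<close> and \<open>B H\<close> have the same kernel, so they are
  proportional.
\<close>

lemma C1_orbit_equivalence_linearization:
  assumes "fin_dim_flow \<Phi> S" "fin_dim_flow \<Psi> T"
    and h: "C1_diffeo sX sY h"
    and \<tau>: "\<And>x. strict_mono (\<lambda>t. \<tau> t x)" and conj: "\<And>t x. h (\<Phi> t x) = \<Psi> (\<tau> t x) (h x)"
  shows "\<exists>\<alpha>>0. similar_ops sX sY (velocity \<Phi>) (\<lambda>y. \<alpha> *\<^sub>R velocity \<Psi> y)"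
proof -
  interpret X: fin_dim_flow \<Phi> S by fact
  interpret Y: fin_dim_flow \<Psi> T by fact
  let ?A = "velocity \<Phi>" and ?B = "velocity \<Psi>"
  have "bij h" using h by (simp add: C1_diffeo_def)
  then have "inj h" by (rule bij_is_inj)
  obtain h' where h'_cont: "continuous_on UNIV h'"
    and h': "\<And>x. (h has_derivative blinfun_apply (h' x)) (at x)"
    and h'_lin: "\<And>x. Vector_Spaces.linear sX sY (blinfun_apply (h' x))"
    using h unfolding C1_diffeo_def C1_map_def by blast
  obtain k' where k': "\<And>y. (inv h has_derivative blinfun_apply (k' y)) (at y)"
    using h unfolding C1_diffeo_def C1_map_def by blast
  define H where "H = blinfun_apply (h' 0)"
  define K where "K = blinfun_apply (k' (h 0))"
  have linH: "linear H" unfolding H_def by (rule bounded_linear.linear[OF blinfun.bounded_linear_right])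
  have KH: "K (H v) = v" for v
  proof -
    have "((\<lambda>x. inv h (h x)) has_derivative (\<lambda>v. K (H v))) (at 0)"
      unfolding H_def K_def by (rule has_derivative_compose[OF h' k'])
    then have "((\<lambda>x. x) has_derivative (\<lambda>v. K (H v))) (at 0)"
      using \<open>inj h\<close> by simp
    then show ?thesis using has_derivative_unique[OF has_derivative_ident] by metis
  qed
  have HK: "H (K w) = w" for w
  proof -
    have "(h has_derivative H) (at (inv h (h 0)))" using h' \<open>inj h\<close> by (simp add: H_def)
    then have "((\<lambda>y. h (inv h y)) has_derivative (\<lambda>w. H (K w))) (at (h 0))"
      unfolding K_def by (rule has_derivative_compose[OF k'])
    then have "((\<lambda>y. y) has_derivative (\<lambda>w. H (K w))) (at (h 0))"
      using \<open>bij h\<close> by (simp add: bij_is_surj surj_f_inv_f)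
    then show ?thesis using has_derivative_unique[OF has_derivative_ident] by metis
  qed
  have iso: "lin_iso sX sY H"
    unfolding lin_iso_def using h'_lin[of 0] KH HK
    by (auto simp: H_def[symmetric] intro!: o_bij[of K H])
  have zero: "?A x = 0 \<longleftrightarrow> ?B (h x) = 0" for x
    by (rule orbit_equivalence_velocity_zero[OF assms(1,2) h'[of x] \<open>inj h\<close> \<tau>[of x]]) (rule conj)
  have dir: "\<exists>c\<ge>0. h' x (?A x) = c *\<^sub>R ?B (h x)" for x
    by (rule orbit_equivalence_velocity_direction[OF assms(1,2) h'[of x] \<open>inj h\<close> \<tau>[of x]]) (rule conj)
  have A0: "?A 0 = 0" by (rule linear_0[OF X.linear_velocity])
  then have B0: "?B (h 0) = 0" using zero by simp
  have ker1: "?B (H v) = 0" if "?A v = 0" for v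
    using derivative_maps_kernel[OF X.linear_velocity Y.bounded_linear_velocity h'[of 0] _ A0 that]
      zero by (simp add: H_def)
  have ker2: "?A v = 0" if "?B (H v) = 0" for v
    using derivative_maps_kernel[OF Y.linear_velocity X.bounded_linear_velocity k'[of "h 0"] _ B0 that]
      zero \<open>bij h\<close> KH by (simp add: K_def bij_is_surj surj_f_inv_f)
  have "\<exists>c>0. H (?A v) = c *\<^sub>R ?B (H v)" if "?B (H v) \<noteq> 0" for v
  proof -
    let ?p = "\<lambda>\<epsilon>. h' (\<epsilon> *\<^sub>R v) (?A v)" and ?q = "\<lambda>\<epsilon>. ?B ((h (0 + \<epsilon> *\<^sub>R v) - h 0) /\<^sub>R \<epsilon>)"
    have "isCont h' 0" using h'_cont by (simp add: continuous_on_eq_continuous_at)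
    moreover have "((\<lambda>\<epsilon>. \<epsilon> *\<^sub>R v) \<longlongrightarrow> 0) (at_right 0)"
      using tendsto_scaleR[OF tendsto_ident_at tendsto_const[of v], of 0] by simp
    ultimately have "((\<lambda>\<epsilon>. h' (\<epsilon> *\<^sub>R v)) \<longlongrightarrow> h' 0) (at_right 0)"
      by (rule isCont_tendsto_compose)
    then have p: "(?p \<longlongrightarrow> H (?A v)) (at_right 0)"
      unfolding H_def by (intro blinfun.tendsto tendsto_const)
    have q: "(?q \<longlongrightarrow> ?B (H v)) (at_right 0)"
      unfolding H_def
      by (rule bounded_linear.tendsto[OF Y.bounded_linear_velocity has_derivative_along_line[OF h']])
    have "\<exists>c\<ge>0. ?p \<epsilon> = c *\<^sub>R ?q \<epsilon>" if "\<epsilon> > 0" for \<epsilon>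
    proof -
      obtain c where c: "c \<ge> 0" "h' (\<epsilon> *\<^sub>R v) (?A (\<epsilon> *\<^sub>R v)) = c *\<^sub>R ?B (h (\<epsilon> *\<^sub>R v))"
        using dir by blast
      then have "\<epsilon> *\<^sub>R ?p \<epsilon> = c *\<^sub>R ?B (h (\<epsilon> *\<^sub>R v))"
        by (simp add: linear_scale[OF X.linear_velocity] blinfun.scaleR_right)
      then have "?p \<epsilon> = (c / \<epsilon>) *\<^sub>R ?B (h (\<epsilon> *\<^sub>R v))"
        using that by (metis (no_types) divideR_right divide_inverse_commute less_numeral_extra(3)
            scaleR_scaleR)
      also have "\<dots> = c *\<^sub>R ?q \<epsilon>"
        by (simp add: linear_scale[OF Y.linear_velocity] linear_diff[OF Y.linear_velocity] B0
            divide_inverse)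
      finally show ?thesis using c(1) by blast
    qed
    then have "\<exists>c\<ge>0. H (?A v) = c *\<^sub>R ?B (H v)"
      by (intro limit_of_nonneg_multiples[OF p q trivial_limit_at_right_real that])
         (auto simp: eventually_at_right_field intro!: exI[of _ 1])
    moreover have "H (?A v) \<noteq> 0"
      using ker1 KH that by (metis linear_0[OF linH])
    ultimately show ?thesis by (metis order_le_less scaleR_zero_left)
  qed
  then have "\<exists>\<alpha>>0. \<forall>v. H (?A v) = \<alpha> *\<^sub>R ?B (H v)"
    using linear_pointwise_proportional[of "\<lambda>v. H (?A v)" "\<lambda>v. ?B (H v)"]
      linear_compose[OF X.linear_velocity linH] linear_compose[OF linH Y.linear_velocity]
      ker2 linear_0[OF linH] by (simp add: o_def)
  then show ?thesis using iso by (auto simp: similar_ops_def fun_eq_iff)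
qed

section \<open>Scalar fields, and the cycle of implications\<close>

lemma real_fin_dim_imp_finite_real_span:
  fixes s :: "real \<Rightarrow> 'a::real_normed_vector \<Rightarrow> 'a"
  assumes "fin_dim_normed_space s"
  shows "\<exists>S :: 'a set. finite S \<and> span S = UNIV"
proof -
  interpret fin_dim_normed_space s by fact
  have "s = scaleR" using scale_of_real by (auto simp: fun_eq_iff)
  then show ?thesis using fin_dim by (simp add: span_raw_def)
qed

text \<open>
  The real span of \<open>B\<close> and \<open>\<i> B\<close> is closed under multiplication by \<open>\<i>\<close>, hence a complex
  subspace; if \<open>B\<close> spans over the complex numbers, it is everything.
\<close>

lemma complex_fin_dim_imp_finite_real_span:
  fixes s :: "complex \<Rightarrow> 'a::real_normed_vector \<Rightarrow> 'a"
  assumes "fin_dim_normed_space s"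
  shows "\<exists>S :: 'a set. finite S \<and> span S = UNIV"
proof -
  interpret V: fin_dim_normed_space s by fact
  obtain B where B: "finite B" "V.span B = UNIV" using V.fin_dim by blast
  define S where "S = B \<union> s \<i> ` B"
  have real_scale: "s \<i> (r *\<^sub>R x) = r *\<^sub>R s \<i> x" for r x
    by (simp flip: V.scale_of_real add: mult.commute)
  have i: "s \<i> x \<in> span S" if "x \<in> span S" for x
    using that
  proof (induction rule: span_induct_alt)
    case base
    show ?case by (simp add: span_zero)
  next
    case (step c x y)
    have "s \<i> x \<in> span S"
      using step(1) by (auto simp: S_def span_base span_neg)
    then show ?case using step by (simp add: V.scale_right_distrib real_scale span_add span_scale)
  qed
  have "V.subspace (span S)"
  proof (rule V.subspaceI)
    fix c x assume x: "x \<in> span S"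
    have "s c x = s (of_real (Re c) + of_real (Im c) * \<i>) x"
      by (metis complex_eq mult.commute)
    also have "\<dots> = Re c *\<^sub>R x + Im c *\<^sub>R s \<i> x"
      by (simp add: V.scale_left_distrib V.scale_of_real flip: V.scale_scale)
    finally show "s c x \<in> span S" using x i by (simp add: span_add span_scale)
  qed (auto intro: span_zero span_add)
  then have "V.span B \<subseteq> span S"
    by (intro V.span_minimal) (auto simp: S_def intro: span_base)
  then show ?thesis using B by (intro exI[of _ S]) (auto simp: S_def)
qed

lemma scalar_linear_imp_real_linear:
  assumes "fin_dim_normed_space sX" "fin_dim_normed_space sY" "Vector_Spaces.linear sX sY f"
  shows "linear f"
proof -
  interpret X: fin_dim_normed_space sX by fact
  interpret Y: fin_dim_normed_space sY by fact
  interpret f: Vector_Spaces.linear sX sY f by fact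
  show ?thesis
    by (rule linearI) (simp_all add: f.add f.scale flip: X.scale_of_real Y.scale_of_real)
qed

lemma linear_flow_imp_fin_dim_flow:
  fixes \<Phi> :: "real \<Rightarrow> 'a::real_normed_vector \<Rightarrow> 'a" and S :: "'a set"
  assumes "fin_dim_normed_space s" "linear_flow s \<Phi>" "finite S" "span S = UNIV"
  shows "fin_dim_flow \<Phi> S"
  using assms scalar_linear_imp_real_linear[OF assms(1,1)]
  by (simp add: fin_dim_flow_def linear_flow_def)

text \<open>
  The velocity is linear over the scalar field because it is a limit of difference quotients
  that are, and multiplication by a scalar is continuous. It is the only generator because an
  exponential determines its operator by differentiation at zero.
\<close>

lemma generator_eq_velocity:
  fixes \<Phi> :: "real \<Rightarrow> 'a::real_normed_vector \<Rightarrow> 'a" and S :: "'a set"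
  assumes s: "fin_dim_normed_space s" and \<Phi>: "linear_flow s \<Phi>" and S: "finite S" "span S = UNIV"
  shows "generator s \<Phi> = velocity \<Phi>"
proof -
  interpret V: fin_dim_normed_space s by fact
  interpret fin_dim_flow \<Phi> S by (rule linear_flow_imp_fin_dim_flow[OF s \<Phi> S])
  have scale: "bounded_linear (s c)" for c
    by (rule bounded_linear_intro[where K = "norm c"])
       (auto simp: V.scale_right_distrib V.norm_scale mult.commute simp flip: V.scale_of_real)
  have "Vector_Spaces.linear s s (velocity \<Phi>)"
    unfolding Vector_Spaces.linear_iff
  proof (intro conjI allI)
    show "velocity \<Phi> (s c x) = s c (velocity \<Phi> x)" for c x
    proof (rule velocity_eqI)
      have "\<Phi> t (s c x) = s c (\<Phi> t x)" for t
        using \<Phi> by (auto simp: linear_flow_def Vector_Spaces.linear_iff)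
      then show "((\<lambda>t. \<Phi> t (s c x)) has_vector_derivative s c (velocity \<Phi> x)) (at 0)"
        using bounded_linear.has_vector_derivative[OF scale velocity_derivative_at_0] by simp
    qed
  qed (auto simp: linear_add[OF linear_velocity] V.vector_space_axioms)
  moreover have "A = velocity \<Phi>"
    if A: "Vector_Spaces.linear s s A" "\<forall>t. \<Phi> t = op_exp (\<lambda>x. t *\<^sub>R A x)" for A
  proof
    fix x
    have "((\<lambda>t. \<Phi> t x) has_vector_derivative A x) (at 0)"
      using op_exp_derivative_at_0[OF S scalar_linear_imp_real_linear[OF s s A(1)], of x] A(2)
      by simp
    then show "A x = velocity \<Phi> x" by (simp add: velocity_eqI)
  qed
  ultimately show ?thesis
    unfolding generator_def using flow_eq_op_exp by (intro the_equality) auto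
qed

text \<open>
  An isomorphism \<open>H\<close> with \<open>H A = \<alpha> B H\<close> carries the exponential series of \<open>t A\<close> to that of \<open>\<alpha> t
  B\<close> term by term.
\<close>

lemma similar_velocities_imp_linearly_flow_equivalent:
  assumes X: "fin_dim_normed_space sX" and Y: "fin_dim_normed_space sY"
    and "fin_dim_flow \<Phi> S" "fin_dim_flow \<Psi> T"
    and "\<alpha> > 0" and sim: "similar_ops sX sY (velocity \<Phi>) (\<lambda>y. \<alpha> *\<^sub>R velocity \<Psi> y)"
  shows "linearly_flow_equivalent sX sY \<Phi> \<Psi>"
proof -
  interpret X: fin_dim_flow \<Phi> S by fact
  interpret Y: fin_dim_flow \<Psi> T by fact
  let ?A = "velocity \<Phi>" and ?B = "velocity \<Psi>"
  obtain H where H: "lin_iso sX sY H" "\<And>x. H (?A x) = \<alpha> *\<^sub>R ?B (H x)"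
    using sim by (auto simp: similar_ops_def fun_eq_iff)
  have linH: "linear H" using scalar_linear_imp_real_linear[OF X Y] H(1) by (simp add: lin_iso_def)
  interpret H: bounded_linear H
    by (rule linear_imp_bounded_linear_fin_dim[OF X.fin X.span linH])
  have "H (\<Phi> t x) = \<Psi> (\<alpha> * t) (H x)" for t x
  proof -
    have pow: "H (((\<lambda>x. t *\<^sub>R ?A x) ^^ n) x) = ((\<lambda>y. (\<alpha> * t) *\<^sub>R ?B y) ^^ n) (H x)" for n
      by (induction n) (simp_all add: H.scaleR H(2) mult.commute)
    have "(\<lambda>n. H (((\<lambda>x. t *\<^sub>R ?A x) ^^ n) x /\<^sub>R fact n)) sums H (op_exp (\<lambda>x. t *\<^sub>R ?A x) x)"
      by (rule H.sums[OF op_exp_sums[OF X.fin X.span X.linear_velocity]])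
    then show ?thesis
      unfolding X.flow_eq_op_exp[of t] Y.flow_eq_op_exp[of "\<alpha> * t"] op_exp_def[of "\<lambda>y. (\<alpha> * t) *\<^sub>R ?B y"]
      by (simp add: H.scaleR pow sums_iff)
  qed
  then show ?thesis using H(1) \<open>\<alpha> > 0\<close> unfolding linearly_flow_equivalent_def by blast
qed

lemma linear_imp_C1_map:
  assumes "Vector_Spaces.linear sX sY H" "bounded_linear H"
  shows "C1_map sX sY H"
  unfolding C1_map_def
  using assms
  by (intro exI[of _ "\<lambda>_. Blinfun H"])
     (simp add: bounded_linear_Blinfun_apply bounded_linear_imp_has_derivative)

lemma lin_iso_imp_C1_diffeo:
  fixes S :: "'a::real_normed_vector set" and T :: "'b::real_normed_vector set"
  assumes X: "fin_dim_normed_space sX" and Y: "fin_dim_normed_space sY"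
    and S: "finite S" "span S = UNIV" and T: "finite T" "span T = UNIV"
    and H: "lin_iso sX sY (H :: 'a \<Rightarrow> 'b)"
  shows "C1_diffeo sX sY H"
proof -
  have lin: "Vector_Spaces.linear sX sY H" and "bij H" using H by (auto simp: lin_iso_def)
  have inv: "Vector_Spaces.linear sY sX (inv H)"
    unfolding Vector_Spaces.linear_iff
  proof (intro conjI allI)
    show "inv H (x + y) = inv H x + inv H y" for x y
      using lin \<open>bij H\<close>
      by (intro inv_f_eq) (auto simp: Vector_Spaces.linear_iff bij_is_inj bij_is_surj surj_f_inv_f)
    show "inv H (sY c x) = sX c (inv H x)" for c x
      using lin \<open>bij H\<close>
      by (intro inv_f_eq) (auto simp: Vector_Spaces.linear_iff bij_is_inj bij_is_surj surj_f_inv_f)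
  qed (use lin in \<open>auto simp: Vector_Spaces.linear_iff\<close>)
  show ?thesis
    unfolding C1_diffeo_def
    using \<open>bij H\<close> lin inv
    by (auto intro!: linear_imp_C1_map linear_imp_bounded_linear_fin_dim[OF S]
        linear_imp_bounded_linear_fin_dim[OF T] scalar_linear_imp_real_linear[OF X Y]
        scalar_linear_imp_real_linear[OF Y X])
qed

text \<open>
  The four statements for an arbitrary scalar field, under the assumption that both spaces have
  finite real dimension; it is this assumption that the real and the complex case establish
  separately.
\<close>

lemma linear_flow_equivalences:
  fixes \<Phi> :: "real \<Rightarrow> 'a::real_normed_vector \<Rightarrow> 'a"
    and \<Psi> :: "real \<Rightarrow> 'b::real_normed_vector \<Rightarrow> 'b"
    and S :: "'a set" and T :: "'b set"
  assumes X: "fin_dim_normed_space sX" and Y: "fin_dim_normed_space sY"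
    and S: "finite S" "span S = UNIV" and T: "finite T" "span T = UNIV"
    and \<Phi>: "linear_flow sX \<Phi>" and \<Psi>: "linear_flow sY \<Psi>"
  shows "(C1_orbit_equivalent sX sY \<Phi> \<Psi> \<longleftrightarrow> C1_flow_equivalent sX sY \<Phi> \<Psi>) \<and>
    (C1_flow_equivalent sX sY \<Phi> \<Psi> \<longleftrightarrow> linearly_flow_equivalent sX sY \<Phi> \<Psi>) \<and>
    (linearly_flow_equivalent sX sY \<Phi> \<Psi> \<longleftrightarrow>
      (\<exists>\<alpha>::real. \<alpha> > 0 \<and>
        similar_ops sX sY (generator sX \<Phi>) (\<lambda>y. \<alpha> *\<^sub>R generator sY \<Psi> y)))"
proof -
  have flows: "fin_dim_flow \<Phi> S" "fin_dim_flow \<Psi> T"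
    using linear_flow_imp_fin_dim_flow X Y \<Phi> \<Psi> S T by blast+
  have gen: "generator sX \<Phi> = velocity \<Phi>" "generator sY \<Psi> = velocity \<Psi>"
    using generator_eq_velocity X Y \<Phi> \<Psi> S T by blast+
  have "linearly_flow_equivalent sX sY \<Phi> \<Psi> \<Longrightarrow> C1_flow_equivalent sX sY \<Phi> \<Psi>"
    unfolding linearly_flow_equivalent_def C1_flow_equivalent_def
    using lin_iso_imp_C1_diffeo[OF X Y S T] by blast
  moreover have "C1_orbit_equivalent sX sY \<Phi> \<Psi>"
    if flow_equiv: "C1_flow_equivalent sX sY \<Phi> \<Psi>"
  proof -
    obtain h \<alpha> where "\<alpha> > 0" "C1_diffeo sX sY h" "\<forall>t x. h (\<Phi> t x) = \<Psi> (\<alpha> * t) (h x)"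
      using flow_equiv unfolding C1_flow_equivalent_def by blast
    then show ?thesis
      unfolding C1_orbit_equivalent_def
      by (intro exI[of _ h] exI[of _ "\<lambda>t x. \<alpha> * t"]) (auto simp: strict_mono_def)
  qed
  moreover have "\<exists>\<alpha>>0. similar_ops sX sY (velocity \<Phi>) (\<lambda>y. \<alpha> *\<^sub>R velocity \<Psi> y)"
    if "C1_orbit_equivalent sX sY \<Phi> \<Psi>"
    using that C1_orbit_equivalence_linearization[OF flows] unfolding C1_orbit_equivalent_def by blast
  moreover have "linearly_flow_equivalent sX sY \<Phi> \<Psi>"
    if "\<exists>\<alpha>>0. similar_ops sX sY (velocity \<Phi>) (\<lambda>y. \<alpha> *\<^sub>R velocity \<Psi> y)"
    using that similar_velocities_imp_linearly_flow_equivalent[OF X Y flows] by blast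
  ultimately show ?thesis unfolding gen by blast
qed

theorem theorem6p2:
  shows "(\<forall>(\<Phi> :: real \<Rightarrow> 'a::real_normed_vector \<Rightarrow> 'a) (\<Psi> :: real \<Rightarrow> 'b::real_normed_vector \<Rightarrow> 'b)
            (sX :: real \<Rightarrow> 'a \<Rightarrow> 'a) (sY :: real \<Rightarrow> 'b \<Rightarrow> 'b).
          fin_dim_normed_space sX \<longrightarrow> fin_dim_normed_space sY \<longrightarrow>
          linear_flow sX \<Phi> \<longrightarrow> linear_flow sY \<Psi> \<longrightarrow>
            (C1_orbit_equivalent sX sY \<Phi> \<Psi> \<longleftrightarrow> C1_flow_equivalent sX sY \<Phi> \<Psi>) \<and>
            (C1_flow_equivalent sX sY \<Phi> \<Psi> \<longleftrightarrow> linearly_flow_equivalent sX sY \<Phi> \<Psi>) \<and>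
            (linearly_flow_equivalent sX sY \<Phi> \<Psi> \<longleftrightarrow>
              (\<exists>\<alpha>::real. \<alpha> > 0 \<and>
                similar_ops sX sY (generator sX \<Phi>) (\<lambda>y. \<alpha> *\<^sub>R generator sY \<Psi> y)))) \<and>
         (\<forall>(\<Phi> :: real \<Rightarrow> 'a \<Rightarrow> 'a) (\<Psi> :: real \<Rightarrow> 'b \<Rightarrow> 'b)
            (sX :: complex \<Rightarrow> 'a \<Rightarrow> 'a) (sY :: complex \<Rightarrow> 'b \<Rightarrow> 'b).
          fin_dim_normed_space sX \<longrightarrow> fin_dim_normed_space sY \<longrightarrow>
          linear_flow sX \<Phi> \<longrightarrow> linear_flow sY \<Psi> \<longrightarrow>
            (C1_orbit_equivalent sX sY \<Phi> \<Psi> \<longleftrightarrow> C1_flow_equivalent sX sY \<Phi> \<Psi>) \<and>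
            (C1_flow_equivalent sX sY \<Phi> \<Psi> \<longleftrightarrow> linearly_flow_equivalent sX sY \<Phi> \<Psi>) \<and>
            (linearly_flow_equivalent sX sY \<Phi> \<Psi> \<longleftrightarrow>
              (\<exists>\<alpha>::real. \<alpha> > 0 \<and>
                similar_ops sX sY (generator sX \<Phi>) (\<lambda>y. \<alpha> *\<^sub>R generator sY \<Psi> y))))"
proof (rule conjI; (rule allI)+; (rule impI)+)
  fix \<Phi> :: "real \<Rightarrow> 'a \<Rightarrow> 'a" and \<Psi> :: "real \<Rightarrow> 'b \<Rightarrow> 'b"
    and sX :: "real \<Rightarrow> 'a \<Rightarrow> 'a" and sY :: "real \<Rightarrow> 'b \<Rightarrow> 'b"
  assume X: "fin_dim_normed_space sX" and Y: "fin_dim_normed_space sY"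
    and flows: "linear_flow sX \<Phi>" "linear_flow sY \<Psi>"
  obtain S :: "'a set" and T :: "'b set"
    where S: "finite S" "span S = UNIV" and T: "finite T" "span T = UNIV"
    using real_fin_dim_imp_finite_real_span[OF X] real_fin_dim_imp_finite_real_span[OF Y] by blast
  show "(C1_orbit_equivalent sX sY \<Phi> \<Psi> \<longleftrightarrow> C1_flow_equivalent sX sY \<Phi> \<Psi>) \<and>
    (C1_flow_equivalent sX sY \<Phi> \<Psi> \<longleftrightarrow> linearly_flow_equivalent sX sY \<Phi> \<Psi>) \<and>
    (linearly_flow_equivalent sX sY \<Phi> \<Psi> \<longleftrightarrow>
      (\<exists>\<alpha>::real. \<alpha> > 0 \<and>
        similar_ops sX sY (generator sX \<Phi>) (\<lambda>y. \<alpha> *\<^sub>R generator sY \<Psi> y)))"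
    by (rule linear_flow_equivalences[OF X Y S T flows])
next
  fix \<Phi> :: "real \<Rightarrow> 'a \<Rightarrow> 'a" and \<Psi> :: "real \<Rightarrow> 'b \<Rightarrow> 'b"
    and sX :: "complex \<Rightarrow> 'a \<Rightarrow> 'a" and sY :: "complex \<Rightarrow> 'b \<Rightarrow> 'b"
  assume X: "fin_dim_normed_space sX" and Y: "fin_dim_normed_space sY"
    and flows: "linear_flow sX \<Phi>" "linear_flow sY \<Psi>"
  obtain S :: "'a set" and T :: "'b set"
    where S: "finite S" "span S = UNIV" and T: "finite T" "span T = UNIV"
    using complex_fin_dim_imp_finite_real_span[OF X] complex_fin_dim_imp_finite_real_span[OF Y]
    by blast
  show "(C1_orbit_equivalent sX sY \<Phi> \<Psi> \<longleftrightarrow> C1_flow_equivalent sX sY \<Phi> \<Psi>) \<and>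
    (C1_flow_equivalent sX sY \<Phi> \<Psi> \<longleftrightarrow> linearly_flow_equivalent sX sY \<Phi> \<Psi>) \<and>
    (linearly_flow_equivalent sX sY \<Phi> \<Psi> \<longleftrightarrow>
      (\<exists>\<alpha>::real. \<alpha> > 0 \<and>
        similar_ops sX sY (generator sX \<Phi>) (\<lambda>y. \<alpha> *\<^sub>R generator sY \<Psi> y)))"
    by (rule linear_flow_equivalences[OF X Y S T flows])
qed

end
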